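(* Let $Q$ be a loop and $\alpha$, $\beta$ congruences of $Q$. Let $\mathcal W$ be defined as follows: (i) If $Q$ is a loop, let $\mathcal W = \{A^{\cdot\cdot}_{x,y}, B^{\cdot\cdot}_{x,y}, A^{\cdot\backslash}_{x,y}, C^{\cdot}_x\}$. (ii) If $Q$ is an inverse property loop, let $\mathcal W = \{A^{\cdot\cdot}_{x,y}, C^{\cdot}_x\}$. (iii) If $Q$ is a group, let $\mathcal W = \{C^{\cdot}_x\}$. (iv) If $Q$ is a commutative loop, let $\mathcal W = \{A^{\cdot\cdot}_{x,y}, A^{\cdot\backslash}_{x,y}\}$. Then, in each case, $$[\alpha,\beta] = \mathrm{Cg}\big(\{(W_{\bar u}(a), W_{\bar v}(a)) : W\in\mathcal W,\ 1\,\alpha\,a,\ \bar u\,\beta\,\bar v\}\big).$$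
   Context: A loop is an algebra $(Q,1,\cdot,\backslash,/)$ satisfying $x\cdot 1=x=1\cdot x$, $x\backslash(x\cdot y)=y$, $x\cdot(x\backslash y)=y$, $(y\cdot x)/x=y$, $(y/x)\cdot x=y$. An inverse property loop is a loop with two-sided inverses $x^{-1}$ satisfying $x^{-1}(xy)=y=(yx)x^{-1}$. For $x\in Q$ define bijections of $Q$ by $L_x(y)=xy$, $R_x(y)=yx$, $M_x(y)=y\backslash x$. Put $$A^{\cdot\cdot}_{y,z}=R_{yz}^{-1}R_zR_y,\quad B^{\cdot\cdot}_{y,z}=L_{zy}^{-1}L_zL_y,\quad A^{\cdot\backslash}_{y,z}=M_{y\backslash z}^{-1}M_zR_y,\quad C^{\cdot}_y=L_y^{-1}R_y,$$ products being compositions of maps (right factor applied first); equivalently $(xy)z=A^{\cdot\cdot}_{y,z}(x)\cdot(yz)$, $z(yx)=(zy)\cdot B^{\cdot\cdot}_{y,z}(x)$, $(xy)\backslash z=A^{\cdot\backslash}_{y,z}(x)\backslash(y\backslash z)$, $xy=y\cdot C^{\cdot}_y(x)$. For such a $W$, $W_{\bar u}$ denotes the mapping obtained by substituting the elements $\bar u$ of $Q$ for the parameters of $W$. For congruences $\alpha,\beta,\delta$ of an algebra, $C(\alpha,\beta;\delta)$ means that for every $(n+1)$-ary term operation $t$, every $a\,\alpha\,b$ and every $u_1\,\beta\,v_1,\dots,u_n\,\beta\,v_n$, $t(a,u_1,\dots,u_n)\,\delta\,t(a,v_1,\dots,v_n)$ implies $t(b,u_1,\dots,u_n)\,\delta\,t(b,v_1,\dots,v_n)$.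 The commutator $[\alpha,\beta]$ is the smallest congruence $\delta$ with $C(\alpha,\beta;\delta)$. $\mathrm{Cg}(X)$ is the congruence generated by $X$. For tuples, $\bar u\,\beta\,\bar v$ means $u_i\,\beta\,v_i$ for all $i$. *)

theory Defs
  imports HOL.Hull
begin

class loop = times + one +
  fixes ldiv :: "'a \<Rightarrow> 'a \<Rightarrow> 'a"  (infixl \<open>\<setminus>\<close> 70)
    and rdiv :: "'a \<Rightarrow> 'a \<Rightarrow> 'a"  (infixl \<open>\<sslash>\<close> 70)
  assumes loop_right_one: "x * 1 = x"
    and loop_left_one: "1 * x = x"
    and ldiv_mult: "x \<setminus> (x * y) = y"
    and mult_ldiv: "x * (x \<setminus> y) = y"
    and mult_rdiv: "(y * x) \<sslash> x = y"
    and rdiv_mult: "(y \<sslash> x) * x = y"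

definition inverse_property_loop :: "'a::loop itself \<Rightarrow> bool" where
  "inverse_property_loop _ \<longleftrightarrow>
    (\<exists>i :: 'a \<Rightarrow> 'a. \<forall>x. x * i x = 1 \<and> i x * x = 1 \<and>
      (\<forall>y. i x * (x * y) = y \<and> (y * x) * i x = y))"

text \<open>A loop is a group iff its multiplication and unit admit an inverse map
  making them an instance of the locale \<^locale>\<open>group\<close> of \<^theory>\<open>HOL.Groups\<close>.\<close>

definition group_loop :: "'a::loop itself \<Rightarrow> bool" where
  "group_loop _ \<longleftrightarrow> (\<exists>i :: 'a \<Rightarrow> 'a. group (*) 1 i)"

definition commutative_loop :: "'a::loop itself \<Rightarrow> bool" where
  "commutative_loop _ \<longleftrightarrow> (\<forall>x y :: 'a. x * y = y * x)"

definition congruence :: "'a::loop rel \<Rightarrow> bool" where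
  "congruence \<theta> \<longleftrightarrow> equiv UNIV \<theta> \<and>
    (\<forall>x x' y y'. (x, x') \<in> \<theta> \<longrightarrow> (y, y') \<in> \<theta> \<longrightarrow>
      (x * y, x' * y') \<in> \<theta> \<and> (x \<setminus> y, x' \<setminus> y') \<in> \<theta> \<and> (x \<sslash> y, x' \<sslash> y') \<in> \<theta>)"

definition Cg :: "'a::loop rel \<Rightarrow> 'a rel" where
  "Cg X = congruence hull X"

text \<open>The \<open>n\<close>-ary term operations act on lists; only their values on lists of length \<open>n\<close>
  are meaningful.\<close>

inductive term_operation :: "nat \<Rightarrow> ('a::loop list \<Rightarrow> 'a) \<Rightarrow> bool" for n where
  proj: "i < n \<Longrightarrow> term_operation n (\<lambda>xs. xs ! i)"
| one: "term_operation n (\<lambda>xs. 1)"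
| mult: "term_operation n s \<Longrightarrow> term_operation n t \<Longrightarrow> term_operation n (\<lambda>xs. s xs * t xs)"
| ldiv: "term_operation n s \<Longrightarrow> term_operation n t \<Longrightarrow> term_operation n (\<lambda>xs. s xs \<setminus> t xs)"
| rdiv: "term_operation n s \<Longrightarrow> term_operation n t \<Longrightarrow> term_operation n (\<lambda>xs. s xs \<sslash> t xs)"

definition centralizes :: "'a::loop rel \<Rightarrow> 'a rel \<Rightarrow> 'a rel \<Rightarrow> bool" where
  "centralizes \<alpha> \<beta> \<delta> \<longleftrightarrow>
    (\<forall>n t a b us vs.
      term_operation (Suc n) t \<longrightarrow> (a, b) \<in> \<alpha> \<longrightarrow>
      length us = n \<longrightarrow> length vs = n \<longrightarrow> (\<forall>i<n. (us ! i, vs ! i) \<in> \<beta>) \<longrightarrow>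
      (t (a # us), t (a # vs)) \<in> \<delta> \<longrightarrow> (t (b # us), t (b # vs)) \<in> \<delta>)"

definition commutator :: "'a::loop rel \<Rightarrow> 'a rel \<Rightarrow> 'a rel" where
  "commutator \<alpha> \<beta> = (LEAST \<delta>. congruence \<delta> \<and> centralizes \<alpha> \<beta> \<delta>)"

lemma congruence_Inter:
  assumes "\<And>\<theta>. \<theta> \<in> S \<Longrightarrow> congruence \<theta>"
  shows "congruence (\<Inter>S)"
proof -
  have "equiv UNIV (\<Inter>S)"
  proof (intro equivI)
    show "refl (\<Inter>S)"
      using assms by (auto simp: congruence_def equiv_def refl_on_def)
    show "sym (\<Inter>S)"
      using assms unfolding congruence_def equiv_def sym_def by blast
    show "trans (\<Inter>S)"
      using assms unfolding congruence_def equiv_def trans_def by blast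
  qed auto
  then show ?thesis
    using assms unfolding congruence_def by blast
qed

lemma centralizes_Inter:
  assumes "\<And>\<delta>. \<delta> \<in> S \<Longrightarrow> centralizes \<alpha> \<beta> \<delta>"
  shows "centralizes \<alpha> \<beta> (\<Inter>S)"
  unfolding centralizes_def
proof (intro allI impI InterI)
  fix n t a b us vs \<delta>
  assume *: "term_operation (Suc n) t" "(a, b) \<in> \<alpha>" "length us = n" "length vs = n"
    "\<forall>i<n. (us ! i, vs ! i) \<in> \<beta>" "(t (a # us), t (a # vs)) \<in> \<Inter>S" and \<delta>: "\<delta> \<in> S"
  from *(6) \<delta> have "(t (a # us), t (a # vs)) \<in> \<delta>" by blast
  with *(1-5) assms[OF \<delta>] show "(t (b # us), t (b # vs)) \<in> \<delta>"
    unfolding centralizes_def by blast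
qed

text \<open>The smallest congruence in the definition of the commutator exists.\<close>

lemma commutator_eq_Inter:
  "commutator \<alpha> \<beta> = \<Inter>{\<delta>. congruence \<delta> \<and> centralizes \<alpha> \<beta> \<delta>}"
proof -
  let ?S = "{\<delta>. congruence \<delta> \<and> centralizes \<alpha> \<beta> \<delta>}"
  have "congruence (\<Inter>?S)"
    by (rule congruence_Inter) blast
  moreover have "centralizes \<alpha> \<beta> (\<Inter>?S)"
    by (rule centralizes_Inter) blast
  ultimately show ?thesis
    unfolding commutator_def by (intro Least_equality) auto
qed

definition L_map :: "'a::loop \<Rightarrow> 'a \<Rightarrow> 'a" where "L_map x y = x * y"
definition R_map :: "'a::loop \<Rightarrow> 'a \<Rightarrow> 'a" where "R_map x y = y * x"
definition M_map :: "'a::loop \<Rightarrow> 'a \<Rightarrow> 'a" where "M_map x y = y \<setminus> x"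

lemma bij_L_map: "bij (L_map x)"
  by (rule o_bij[where g = "\<lambda>y. x \<setminus> y"]) (auto simp: L_map_def fun_eq_iff ldiv_mult mult_ldiv)

lemma bij_R_map: "bij (R_map x)"
  by (rule o_bij[where g = "\<lambda>y. y \<sslash> x"]) (auto simp: R_map_def fun_eq_iff mult_rdiv rdiv_mult)

lemma bij_M_map: "bij (M_map x)"
proof (rule o_bij[where g = "\<lambda>y. x \<sslash> y"])
  have "x \<sslash> (y \<setminus> x) = y" for y
    using mult_rdiv[of y "y \<setminus> x"] by (simp add: mult_ldiv)
  then show "(\<lambda>y. x \<sslash> y) \<circ> M_map x = id"
    by (simp add: M_map_def fun_eq_iff)
  have "(x \<sslash> y) \<setminus> x = y" for y
    using ldiv_mult[of "x \<sslash> y" y] by (simp add: rdiv_mult)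
  then show "M_map x \<circ> (\<lambda>y. x \<sslash> y) = id"
    by (simp add: M_map_def fun_eq_iff)
qed

definition A_mult :: "'a::loop \<Rightarrow> 'a \<Rightarrow> 'a \<Rightarrow> 'a" where
  "A_mult y z = inv (R_map (y * z)) \<circ> R_map z \<circ> R_map y"

definition B_mult :: "'a::loop \<Rightarrow> 'a \<Rightarrow> 'a \<Rightarrow> 'a" where
  "B_mult y z = inv (L_map (z * y)) \<circ> L_map z \<circ> L_map y"

definition A_ldiv :: "'a::loop \<Rightarrow> 'a \<Rightarrow> 'a \<Rightarrow> 'a" where
  "A_ldiv y z = inv (M_map (y \<setminus> z)) \<circ> M_map z \<circ> R_map y"

definition C_mult :: "'a::loop \<Rightarrow> 'a \<Rightarrow> 'a" where
  "C_mult y = inv (L_map y) \<circ> R_map y"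

text \<open>Families of self-maps of the loop, with one or two loop elements as parameters.\<close>

datatype 'a family = Unary "'a \<Rightarrow> 'a \<Rightarrow> 'a" | Binary "'a \<Rightarrow> 'a \<Rightarrow> 'a \<Rightarrow> 'a"

text \<open>For a family \<open>W\<close>, the set of all pairs \<open>(W\<^sub>u a, W\<^sub>v a)\<close> with
  \<open>1 \<alpha> a\<close> and parameter tuples \<open>u \<beta> v\<close>.\<close>

fun family_pairs :: "'a::loop rel \<Rightarrow> 'a rel \<Rightarrow> 'a family \<Rightarrow> 'a rel" where
  "family_pairs \<alpha> \<beta> (Unary W) =
    {(W u a, W v a) | a u v. (1, a) \<in> \<alpha> \<and> (u, v) \<in> \<beta>}"
| "family_pairs \<alpha> \<beta> (Binary W) =
    {(W u u' a, W v v' a) | a u u' v v'. (1, a) \<in> \<alpha> \<and> (u, v) \<in> \<beta> \<and> (u', v') \<in> \<beta>}"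

end

(*
  Fix congruences \<alpha>, \<beta>, \<delta>, let \<pi> = \<beta> O \<delta> and let N be the \<alpha>-class of 1.  On the
  subalgebra \<pi> of the square of the loop, call (s,s') and (t,t') related if t / s and
  t' / s' are \<delta>-congruent elements of N.  If the maps A, B, C take \<delta>-congruent values on N
  under \<beta>-changes of their parameters, then this relation is a congruence: A governs right
  translations, symmetry and transitivity, while B and C govern left translations.  By
  induction, for a \<alpha> b and u \<beta> v every term t has t(b,u) / t(a,u) \<delta>-congruent to
  t(b,v) / t(a,v), which yields C(\<alpha>,\<beta>;\<delta>).  Conversely, each of the maps is a term fixing 1,
  so its pairs lie in the commutator.  In the special cases, B reduces to A: in an inverse
  property loop by conjugation with the inversion, which is an antiautomorphism.
*)
theory Submission
  imports Defs
begin

section \<open>Loop identities and term formulas for the inner maps\<close>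

lemmas loop_simps = loop_right_one loop_left_one ldiv_mult mult_ldiv mult_rdiv rdiv_mult

lemma ldiv_self [simp]: "x \<setminus> x = (1 :: 'a::loop)"
  by (metis ldiv_mult loop_right_one)

lemma rdiv_self [simp]: "x \<sslash> x = (1 :: 'a::loop)"
  by (metis mult_rdiv loop_left_one)

lemma inv_L_map: "inv (L_map x) y = x \<setminus> y"
  by (metis L_map_def bij_L_map bij_inv_eq_iff mult_ldiv)

lemma inv_R_map: "inv (R_map x) y = y \<sslash> x"
  by (metis R_map_def bij_R_map bij_inv_eq_iff rdiv_mult)

lemma inv_M_map: "inv (M_map x) y = x \<sslash> y"
  by (metis M_map_def bij_M_map bij_inv_eq_iff ldiv_mult rdiv_mult)

lemma A_mult_eq: "A_mult y z x = ((x * y) * z) \<sslash> (y * z)"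
  by (simp add: A_mult_def inv_R_map R_map_def)

lemma B_mult_eq: "B_mult y z x = (z * y) \<setminus> (z * (y * x))"
  by (simp add: B_mult_def inv_L_map L_map_def)

lemma A_ldiv_eq: "A_ldiv y z x = (y \<setminus> z) \<sslash> ((x * y) \<setminus> z)"
  by (simp add: A_ldiv_def inv_M_map M_map_def R_map_def)

lemma C_mult_eq: "C_mult y x = y \<setminus> (x * y)"
  by (simp add: C_mult_def inv_L_map R_map_def)

lemmas family_map_eqs = A_mult_eq B_mult_eq A_ldiv_eq C_mult_eq

lemma A_mult_shift: "A_mult y z x * (y * z) = (x * y) * z"
  by (simp add: A_mult_eq loop_simps)

section \<open>Reductions in inverse property loops, groups and commutative loops\<close>

lemma inverse_property_loop_B_mult:
  assumes "inverse_property_loop TYPE('a::loop)"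
  shows "B_mult y z (x :: 'a) = A_mult (y \<setminus> 1) (z \<setminus> 1) (x \<setminus> 1) \<setminus> 1"
proof -
  obtain i :: "'a \<Rightarrow> 'a" where i: "\<And>x. x * i x = 1" "\<And>x. i x * x = 1"
    "\<And>x y. i x * (x * y) = y" "\<And>x y. (y * x) * i x = y"
    using assms unfolding inverse_property_loop_def by blast
  have i_eq: "x \<setminus> 1 = i x" for x
    by (metis i(1) ldiv_mult)
  have i_i: "i (i x) = x" for x
    by (metis i(2,3) loop_right_one)
  \<comment> \<open>Since \<open>(x * y) * i y = x\<close>, cancelling \<open>x * y\<close> gives
    \<open>i (x * y) * x = i y\<close>; multiply by \<open>i x\<close> on the right.\<close>
  have i_mult: "i (x * y) = i y * i x" for x y
    by (metis i(3,4))
  let ?a = "A_mult (i y) (i z) (i x)"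
  \<comment> \<open>Inversion reverses the products in the identity that characterises
    \<open>?a\<close>, which turns it into the one that characterises
    \<open>B_mult y z x\<close>.\<close>
  have "i (?a * (i y * i z)) = i ((i x * i y) * i z)"
    by (simp add: A_mult_shift)
  then have "(z * y) * i ?a = z * (y * x)"
    by (simp add: i_mult i_i)
  then have "B_mult y z x = i ?a"
    by (metis B_mult_eq ldiv_mult)
  then show ?thesis
    by (simp add: i_eq)
qed

lemma group_loop_A_mult:
  assumes "group_loop TYPE('a::loop)"
  shows "A_mult y z (x :: 'a) = x"
proof -
  obtain i :: "'a \<Rightarrow> 'a" where "group (*) 1 i"
    using assms unfolding group_loop_def by blast
  then interpret g: group "(*)" "1 :: 'a" i .
  show ?thesis
    by (simp add: A_mult_eq g.assoc mult_rdiv)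
qed

lemma group_loop_B_mult:
  assumes "group_loop TYPE('a::loop)"
  shows "B_mult y z (x :: 'a) = x"
proof -
  obtain i :: "'a \<Rightarrow> 'a" where "group (*) 1 i"
    using assms unfolding group_loop_def by blast
  then interpret g: group "(*)" "1 :: 'a" i .
  show ?thesis
    by (simp add: B_mult_eq ldiv_mult flip: g.assoc)
qed

text \<open>Reversing all products turns \<open>z * (y * x) = (z * y) * B_mult y z x\<close> into
  the equation that determines \<open>A_mult y z x\<close>.\<close>

lemma commutative_loop_B_mult:
  assumes "commutative_loop TYPE('a::loop)"
  shows "B_mult y z (x :: 'a) = A_mult y z x"
  using assms unfolding commutative_loop_def by (metis A_mult_shift B_mult_eq ldiv_mult)

lemma commutative_loop_C_mult:
  assumes "commutative_loop TYPE('a::loop)"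
  shows "C_mult y (x :: 'a) = x"
  using assms unfolding commutative_loop_def by (metis C_mult_eq ldiv_mult)

section \<open>Congruences, generated congruences and the commutator\<close>

context
  fixes \<theta> :: "'a::loop rel"
  assumes \<theta>: "congruence \<theta>"
begin

lemma congruence_refl: "(x, x) \<in> \<theta>"
  using \<theta> unfolding congruence_def equiv_def refl_on_def by blast

lemma congruence_sym: "(x, y) \<in> \<theta> \<Longrightarrow> (y, x) \<in> \<theta>"
  using \<theta> unfolding congruence_def equiv_def sym_def by blast

lemma congruence_trans: "(x, y) \<in> \<theta> \<Longrightarrow> (y, z) \<in> \<theta> \<Longrightarrow> (x, z) \<in> \<theta>"
  using \<theta> unfolding congruence_def equiv_def trans_def by blast

lemma congruence_ops:
  assumes "(x, x') \<in> \<theta>" "(y, y') \<in> \<theta>"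
  shows "(x * y, x' * y') \<in> \<theta>" "(x \<setminus> y, x' \<setminus> y') \<in> \<theta>" "(x \<sslash> y, x' \<sslash> y') \<in> \<theta>"
  using \<theta> assms unfolding congruence_def by blast+

end

lemma congruence_Cg: "congruence (Cg X)"
  unfolding Cg_def by (metis congruence_Inter hull_in)

lemma Cg_superset: "X \<subseteq> Cg X"
  unfolding Cg_def by (rule hull_subset)

lemma Cg_least: "congruence \<theta> \<Longrightarrow> X \<subseteq> \<theta> \<Longrightarrow> Cg X \<subseteq> \<theta>"
  unfolding Cg_def by (metis hull_minimal)

lemma congruence_commutator: "congruence (commutator \<alpha> \<beta>)"
  unfolding commutator_eq_Inter by (rule congruence_Inter) blast

lemma centralizes_commutator: "centralizes \<alpha> \<beta> (commutator \<alpha> \<beta>)"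
  unfolding commutator_eq_Inter by (rule centralizes_Inter) blast

lemma commutator_least: "congruence \<delta> \<Longrightarrow> centralizes \<alpha> \<beta> \<delta> \<Longrightarrow> commutator \<alpha> \<beta> \<subseteq> \<delta>"
  unfolding commutator_eq_Inter by blast

text \<open>This is the common interface of the four cases: each derives these conditions from its
  own pairs, and \<open>centralizes \<alpha> \<beta> \<delta>\<close> is then proved once.\<close>

locale invariant_inner_maps =
  fixes \<alpha> \<beta> \<delta> :: "'a::loop rel"
  assumes \<alpha>: "congruence \<alpha>" and \<beta>: "congruence \<beta>" and \<delta>: "congruence \<delta>"
    and A_invariant: "\<lbrakk>(1, p) \<in> \<alpha>; (y, y') \<in> \<beta>; (z, z') \<in> \<beta>\<rbrakk> \<Longrightarrow> (A_mult y z p, A_mult y' z' p) \<in> \<delta>"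
    and B_invariant: "\<lbrakk>(1, p) \<in> \<alpha>; (y, y') \<in> \<beta>; (z, z') \<in> \<beta>\<rbrakk> \<Longrightarrow> (B_mult y z p, B_mult y' z' p) \<in> \<delta>"
    and C_invariant: "\<lbrakk>(1, p) \<in> \<alpha>; (y, y') \<in> \<beta>\<rbrakk> \<Longrightarrow> (C_mult y p, C_mult y' p) \<in> \<delta>"
begin

section \<open>The subalgebra \<open>\<pi>\<close> of the square and the relation
  \<open>\<Delta>\<close> on it\<close>

definition \<pi> :: "'a rel" where "\<pi> = \<beta> O \<delta>"

definition \<epsilon> :: "'a rel" where "\<epsilon> = {(p, p') \<in> \<delta>. (1, p) \<in> \<alpha> \<and> (1, p') \<in> \<alpha>}"

text \<open>Right division makes the quotients left factors: \<open>t = p * s\<close> and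
  \<open>t' = p' * s'\<close> with \<open>(p, p') \<in> \<epsilon>\<close>.\<close>

definition \<Delta> :: "('a \<times> 'a) rel" where
  "\<Delta> = {((s, s'), (t, t')). (s, s') \<in> \<pi> \<and> (t, t') \<in> \<pi> \<and> (t \<sslash> s, t' \<sslash> s') \<in> \<epsilon>}"

lemma \<pi>_refl: "(x, x) \<in> \<pi>"
  unfolding \<pi>_def using congruence_refl[OF \<beta>] congruence_refl[OF \<delta>] by blast

lemma \<pi>_ops:
  assumes "(x, x') \<in> \<pi>" "(y, y') \<in> \<pi>"
  shows "(x * y, x' * y') \<in> \<pi>" "(x \<setminus> y, x' \<setminus> y') \<in> \<pi>" "(x \<sslash> y, x' \<sslash> y') \<in> \<pi>"
proof -
  obtain v w where "(x, v) \<in> \<beta>" "(v, x') \<in> \<delta>" "(y, w) \<in> \<beta>" "(w, y') \<in> \<delta>"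
    using assms unfolding \<pi>_def by blast
  then show "(x * y, x' * y') \<in> \<pi>" "(x \<setminus> y, x' \<setminus> y') \<in> \<pi>" "(x \<sslash> y, x' \<sslash> y') \<in> \<pi>"
    unfolding \<pi>_def by (blast intro: relcompI congruence_ops[OF \<beta>] congruence_ops[OF \<delta>])+
qed

text \<open>Composing \<beta> with \<delta> in \<open>\<pi>\<close> makes this hold: quotients,
  known to be \<delta>-congruent, may serve as parameters of the inner maps.\<close>

lemma \<epsilon>_imp_\<pi>: "(p, p') \<in> \<epsilon> \<Longrightarrow> (p, p') \<in> \<pi>"
  unfolding \<epsilon>_def \<pi>_def using congruence_refl[OF \<beta>] by blast

lemma \<epsilon>_one: "(1, 1) \<in> \<epsilon>"
  unfolding \<epsilon>_def using congruence_refl[OF \<alpha>] congruence_refl[OF \<delta>] by blast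

lemma \<epsilon>_ops:
  assumes "(x, x') \<in> \<epsilon>" "(y, y') \<in> \<epsilon>"
  shows "(x * y, x' * y') \<in> \<epsilon>" "(x \<sslash> y, x' \<sslash> y') \<in> \<epsilon>"
proof -
  have "(1, p * q) \<in> \<alpha>" "(1, p \<sslash> q) \<in> \<alpha>" if "(1, p) \<in> \<alpha>" "(1, q) \<in> \<alpha>" for p q
    using congruence_ops[OF \<alpha> that] by (simp_all add: loop_simps)
  then show "(x * y, x' * y') \<in> \<epsilon>" "(x \<sslash> y, x' \<sslash> y') \<in> \<epsilon>"
    using assms by (simp_all add: \<epsilon>_def congruence_ops[OF \<delta>])
qed


text \<open>The parameters first move along \<beta> by invariance, then along \<delta>, together
  with \<open>p\<close>, by compatibility. The values stay in the \<alpha>-class of 1 because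
  \<open>W\<close> fixes 1.\<close>

lemma \<epsilon>_family:
  assumes invariant: "\<And>p y y' z z'. \<lbrakk>(1, p) \<in> \<alpha>; (y, y') \<in> \<beta>; (z, z') \<in> \<beta>\<rbrakk> \<Longrightarrow> (W y z p, W y' z' p) \<in> \<delta>"
    and compatible: "\<And>\<theta> p p' y y' z z'. \<lbrakk>congruence \<theta>; (p, p') \<in> \<theta>; (y, y') \<in> \<theta>; (z, z') \<in> \<theta>\<rbrakk>
      \<Longrightarrow> (W y z p, W y' z' p') \<in> \<theta>"
    and one: "\<And>y z. W y z 1 = 1"
    and "(p, p') \<in> \<epsilon>" "(y, y') \<in> \<pi>" "(z, z') \<in> \<pi>"
  shows "(W y z p, W y' z' p') \<in> \<epsilon>"
proof -
  obtain v w where vw: "(y, v) \<in> \<beta>" "(v, y') \<in> \<delta>" "(z, w) \<in> \<beta>" "(w, z') \<in> \<delta>"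
    using assms unfolding \<pi>_def by blast
  have p: "(p, p') \<in> \<delta>" "(1, p) \<in> \<alpha>" "(1, p') \<in> \<alpha>"
    using assms unfolding \<epsilon>_def by auto
  have "(1, W y z q) \<in> \<alpha>" if "(1, q) \<in> \<alpha>" for y z q
    using compatible[OF \<alpha> that congruence_refl[OF \<alpha>] congruence_refl[OF \<alpha>]] by (simp add: one)
  moreover have "(W y z p, W y' z' p') \<in> \<delta>"
    using invariant[OF p(2) vw(1,3)] compatible[OF \<delta> p(1) vw(2,4)] by (rule congruence_trans[OF \<delta>])
  ultimately show ?thesis
    using p unfolding \<epsilon>_def by blast
qed

text \<open>Invariance passes to the inverse maps: for \<open>q = V y z p\<close> it relates
  \<open>p = W y z q\<close> to \<open>W y' z' q\<close>, and applying \<open>V y' z'\<close>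
  relates \<open>V y' z' p\<close> to \<open>q\<close>.\<close>

lemma \<epsilon>_inverse_family:
  assumes invariant: "\<And>p y y' z z'. \<lbrakk>(1, p) \<in> \<alpha>; (y, y') \<in> \<beta>; (z, z') \<in> \<beta>\<rbrakk> \<Longrightarrow> (W y z p, W y' z' p) \<in> \<delta>"
    and compatible: "\<And>\<theta> p p' y y' z z'. \<lbrakk>congruence \<theta>; (p, p') \<in> \<theta>; (y, y') \<in> \<theta>; (z, z') \<in> \<theta>\<rbrakk>
      \<Longrightarrow> (V y z p, V y' z' p') \<in> \<theta>"
    and inverse: "\<And>y z p. W y z (V y z p) = p" "\<And>y z p. V y z (W y z p) = p"
    and one: "\<And>y z. V y z 1 = 1"
    and "(p, p') \<in> \<epsilon>" "(y, y') \<in> \<pi>" "(z, z') \<in> \<pi>"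
  shows "(V y z p, V y' z' p') \<in> \<epsilon>"
proof (rule \<epsilon>_family[where W = V, OF _ compatible one assms(6-8)])
  fix p y y' z z'
  assume *: "(1, p) \<in> \<alpha>" "(y, y') \<in> \<beta>" "(z, z') \<in> \<beta>"
  have "(1, V y z p) \<in> \<alpha>"
    using compatible[OF \<alpha> *(1) congruence_refl[OF \<alpha>] congruence_refl[OF \<alpha>]] by (simp add: one)
  then have "(p, W y' z' (V y z p)) \<in> \<delta>"
    using invariant[OF _ *(2,3), of "V y z p"] by (simp add: inverse)
  then show "(V y z p, V y' z' p) \<in> \<delta>"
    using compatible[OF \<delta> _ congruence_refl[OF \<delta>] congruence_refl[OF \<delta>]] congruence_sym[OF \<delta>]
    by (metis inverse(2))
qed

context
  fixes p p' y y' z z'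
  assumes p: "(p, p') \<in> \<epsilon>" and y: "(y, y') \<in> \<pi>" and z: "(z, z') \<in> \<pi>"
begin

lemma \<epsilon>_A: "(A_mult y z p, A_mult y' z' p') \<in> \<epsilon>"
  by (rule \<epsilon>_family[where W = A_mult, OF A_invariant _ _ p y z])
    (auto simp: A_mult_eq loop_simps intro!: congruence_ops)

text \<open>The term solves \<open>(x * y) * z = p * (y * z)\<close> for \<open>x\<close>, so it
  inverts \<open>A_mult y z\<close>.\<close>

lemma \<epsilon>_A_inverse: "(((p * (y * z)) \<sslash> z) \<sslash> y, ((p' * (y' * z')) \<sslash> z') \<sslash> y') \<in> \<epsilon>"
  by (rule \<epsilon>_inverse_family[where W = A_mult and V = "\<lambda>y z p. ((p * (y * z)) \<sslash> z) \<sslash> y", OF A_invariant _ _ _ _ p y z])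
    (auto simp: A_mult_eq loop_simps intro!: congruence_ops)

lemma \<epsilon>_B: "(B_mult y z p, B_mult y' z' p') \<in> \<epsilon>"
  by (rule \<epsilon>_family[where W = B_mult, OF B_invariant _ _ p y z])
    (auto simp: B_mult_eq loop_simps intro!: congruence_ops)

lemma \<epsilon>_B_inverse: "(y \<setminus> (z \<setminus> ((z * y) * p)), y' \<setminus> (z' \<setminus> ((z' * y') * p'))) \<in> \<epsilon>"
  by (rule \<epsilon>_inverse_family[where W = B_mult and V = "\<lambda>y z p. y \<setminus> (z \<setminus> ((z * y) * p))", OF B_invariant _ _ _ _ p y z])
    (auto simp: B_mult_eq loop_simps intro!: congruence_ops)

lemma \<epsilon>_C: "(C_mult y p, C_mult y' p') \<in> \<epsilon>"
  \<comment> \<open>A dummy second parameter makes the unary map an instance of the binary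
    lemma.\<close>
  by (rule \<epsilon>_family[where W = "\<lambda>y z. C_mult y", OF C_invariant _ _ p y z])
    (auto simp: C_mult_eq loop_simps intro!: congruence_ops)

lemma \<epsilon>_C_inverse: "((y * p) \<sslash> y, (y' * p') \<sslash> y') \<in> \<epsilon>"
  by (rule \<epsilon>_inverse_family[where W = "\<lambda>y z. C_mult y" and V = "\<lambda>y z p. (y * p) \<sslash> y", OF C_invariant _ _ _ _ p y z])
    (auto simp: C_mult_eq loop_simps intro!: congruence_ops)

end

section \<open>\<open>\<Delta>\<close> is a congruence of \<open>\<pi>\<close>\<close>

lemma \<Delta>D:
  assumes "((s, s'), (t, t')) \<in> \<Delta>"
  shows "(s, s') \<in> \<pi>" "(t, t') \<in> \<pi>" "(t \<sslash> s, t' \<sslash> s') \<in> \<epsilon>"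
  using assms by (auto simp: \<Delta>_def)

lemma \<Delta>_refl: "(x, x') \<in> \<pi> \<Longrightarrow> ((x, x'), (x, x')) \<in> \<Delta>"
  by (simp add: \<Delta>_def \<epsilon>_one)

lemma \<Delta>_sym:
  assumes "((s, s'), (t, t')) \<in> \<Delta>"
  shows "((t, t'), (s, s')) \<in> \<Delta>"
proof -
  \<comment> \<open>With \<open>t = p s\<close>, the quotient \<open>s / t\<close> arises by moving \<open>1 / p\<close> across \<open>((1 / p) p) s\<close>.\<close>
  have eq: "s \<sslash> t = A_mult (t \<sslash> s) s (1 \<sslash> (t \<sslash> s))" for s t :: 'a
    by (simp add: A_mult_eq loop_simps)
  note st = \<Delta>D[OF assms]
  have "(s \<sslash> t, s' \<sslash> t') \<in> \<epsilon>"
    unfolding eq[of s t] eq[of s' t']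
    using \<epsilon>_A[OF \<epsilon>_ops(2)[OF \<epsilon>_one st(3)] \<epsilon>_imp_\<pi>[OF st(3)] st(1)] .
  then show ?thesis
    using st unfolding \<Delta>_def by simp
qed

lemma \<Delta>_trans:
  assumes "((r, r'), (s, s')) \<in> \<Delta>" "((s, s'), (t, t')) \<in> \<Delta>"
  shows "((r, r'), (t, t')) \<in> \<Delta>"
proof -
  \<comment> \<open>With \<open>p = s \<sslash> r\<close> and \<open>q = t \<sslash> s\<close>, the
    inverse of \<open>A_mult p r\<close> sends \<open>q\<close> to the element \<open>x\<close> with
    \<open>q * (p * r) = (x * p) * r\<close>; hence the quotient is \<open>x * p\<close>.\<close>
  have eq: "t \<sslash> r = ((((t \<sslash> s) * ((s \<sslash> r) * r)) \<sslash> r) \<sslash> (s \<sslash> r)) * (s \<sslash> r)" for r s t :: 'a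
    by (simp add: loop_simps)
  note r = \<Delta>D[OF assms(1)] and s = \<Delta>D[OF assms(2)]
  have "(t \<sslash> r, t' \<sslash> r') \<in> \<epsilon>"
    unfolding eq[of t r s] eq[of t' r' s']
    using \<epsilon>_ops(1)[OF \<epsilon>_A_inverse[OF s(3) \<epsilon>_imp_\<pi>[OF r(3)] r(1)] r(3)] .
  then show ?thesis
    using r s unfolding \<Delta>_def by simp
qed

lemma \<Delta>_mult_right:
  assumes "((s, s'), (t, t')) \<in> \<Delta>" "(z, z') \<in> \<pi>"
  shows "((s * z, s' * z'), (t * z, t' * z')) \<in> \<Delta>"
proof -
  \<comment> \<open>With \<open>t = p * s\<close>, \<open>A_mult s z\<close> rebrackets
    \<open>(p * s) * z\<close>.\<close>
  have eq: "(t * z) \<sslash> (s * z) = A_mult s z (t \<sslash> s)" for s t :: 'a and z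
    by (simp add: A_mult_eq loop_simps)
  note st = \<Delta>D[OF assms(1)]
  have "((t * z) \<sslash> (s * z), (t' * z') \<sslash> (s' * z')) \<in> \<epsilon>"
    unfolding eq using \<epsilon>_A[OF st(3,1) assms(2)] .
  then show ?thesis
    using \<pi>_ops(1)[OF st(1) assms(2)] \<pi>_ops(1)[OF st(2) assms(2)] st(3) unfolding \<Delta>_def by simp
qed

lemma \<Delta>_rdiv_right:
  assumes "((s, s'), (t, t')) \<in> \<Delta>" "(z, z') \<in> \<pi>"
  shows "((s \<sslash> z, s' \<sslash> z'), (t \<sslash> z, t' \<sslash> z')) \<in> \<Delta>"
proof -
  \<comment> \<open>Put \<open>w = s \<sslash> z\<close>. Then \<open>t = p * (w * z)\<close>, and
    the inverse of \<open>A_mult w z\<close> moves the bracket so that \<open>z\<close>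
    cancels.\<close>
  have eq: "(t \<sslash> z) \<sslash> (s \<sslash> z) = (((t \<sslash> s) * ((s \<sslash> z) * z)) \<sslash> z) \<sslash> (s \<sslash> z)" for s t z :: 'a
    by (simp add: loop_simps)
  note st = \<Delta>D[OF assms(1)]
  have "((t \<sslash> z) \<sslash> (s \<sslash> z), (t' \<sslash> z') \<sslash> (s' \<sslash> z')) \<in> \<epsilon>"
    unfolding eq[of t z s] eq[of t' z' s'] using \<epsilon>_A_inverse[OF st(3) \<pi>_ops(3)[OF st(1) assms(2)] assms(2)] .
  then show ?thesis
    using \<pi>_ops(3)[OF st(1) assms(2)] \<pi>_ops(3)[OF st(2) assms(2)] st(3) unfolding \<Delta>_def by simp
qed

lemma \<Delta>_mult_left:
  assumes "((s, s'), (t, t')) \<in> \<Delta>" "(z, z') \<in> \<pi>"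
  shows "((z * s, z' * s'), (z * t, z' * t')) \<in> \<Delta>"
proof -
  \<comment> \<open>\<open>C_mult s\<close> turns the left factor \<open>p\<close> of
    \<open>t = p * s\<close> into a right factor, \<open>B_mult s z\<close> moves it out of
    \<open>z * (s * _)\<close>, and the inverse of \<open>C_mult (z * s)\<close> makes it a left
    factor again.\<close>
  have eq: "(z * t) \<sslash> (z * s) = ((z * s) * B_mult s z (C_mult s (t \<sslash> s))) \<sslash> (z * s)" for s t z :: 'a
    by (simp add: B_mult_eq C_mult_eq loop_simps)
  note st = \<Delta>D[OF assms(1)]
  have "((z * t) \<sslash> (z * s), (z' * t') \<sslash> (z' * s')) \<in> \<epsilon>"
    unfolding eq[of z t s] eq[of z' t' s']
    \<comment> \<open>The second copy of \<open>st(1)\<close> and the final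
      \<open>\<pi>_refl\<close> fill the dummy parameter of the lemmas on
      \<open>C_mult\<close>.\<close>
    using \<epsilon>_C_inverse[OF \<epsilon>_B[OF \<epsilon>_C[OF st(3,1,1)] st(1) assms(2)] \<pi>_ops(1)[OF assms(2) st(1)] \<pi>_refl] .
  then show ?thesis
    using \<pi>_ops(1)[OF assms(2) st(1)] \<pi>_ops(1)[OF assms(2) st(2)] st(3) unfolding \<Delta>_def by simp
qed

lemma \<Delta>_ldiv_left:
  assumes "((s, s'), (t, t')) \<in> \<Delta>" "(z, z') \<in> \<pi>"
  shows "((z \<setminus> s, z' \<setminus> s'), (z \<setminus> t, z' \<setminus> t')) \<in> \<Delta>"
proof -
  \<comment> \<open>Here \<open>s = z * w\<close>, so a right factor of \<open>s\<close> moves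
    inside by the inverse of \<open>B_mult w z\<close>, after which \<open>z\<close>
    cancels.\<close>
  have eq: "(z \<setminus> t) \<sslash> w = (w * (w \<setminus> (z \<setminus> ((z * w) * C_mult s (t \<sslash> s))))) \<sslash> w"
    if "w = z \<setminus> s" for s t z w :: 'a
    by (simp add: that C_mult_eq loop_simps)
  note st = \<Delta>D[OF assms(1)]
  note w = \<pi>_ops(2)[OF assms(2) st(1)]
  have "((z \<setminus> t) \<sslash> (z \<setminus> s), (z' \<setminus> t') \<sslash> (z' \<setminus> s')) \<in> \<epsilon>"
    unfolding eq[OF refl, of z t s] eq[OF refl, of z' t' s']
    using \<epsilon>_C_inverse[OF \<epsilon>_B_inverse[OF \<epsilon>_C[OF st(3,1,1)] w assms(2)] w \<pi>_refl] .
  then show ?thesis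
    using \<pi>_ops(2)[OF assms(2) st(1)] \<pi>_ops(2)[OF assms(2) st(2)] st(3) unfolding \<Delta>_def by simp
qed

context
  fixes s s' t t' x x' y y'
  assumes st: "((s, s'), (t, t')) \<in> \<Delta>" and xy: "((x, x'), (y, y')) \<in> \<Delta>"
begin

text \<open>One factor changes at a time, through the pair \<open>(t * x, t' * x')\<close>.\<close>

lemma \<Delta>_mult: "((s * x, s' * x'), (t * y, t' * y')) \<in> \<Delta>"
  using \<Delta>_trans[OF \<Delta>_mult_right[OF st \<Delta>D(1)[OF xy]] \<Delta>_mult_left[OF xy \<Delta>D(2)[OF st]]] .

text \<open>Since \<open>t (s \<setminus> x) \<Delta> s (s \<setminus> x) = x \<Delta> y\<close>, left division by \<open>t\<close> gives \<open>s \<setminus> x \<Delta> t \<setminus> y\<close>; dually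
  for right division.\<close>

lemma \<Delta>_ldiv: "((s \<setminus> x, s' \<setminus> x'), (t \<setminus> y, t' \<setminus> y')) \<in> \<Delta>"
proof -
  have "((t * (s \<setminus> x), t' * (s' \<setminus> x')), (x, x')) \<in> \<Delta>"
    using \<Delta>_mult_right[OF \<Delta>_sym[OF st] \<pi>_ops(2)[OF \<Delta>D(1)[OF st] \<Delta>D(1)[OF xy]]]
    by (simp add: loop_simps)
  from \<Delta>_ldiv_left[OF \<Delta>_trans[OF this xy] \<Delta>D(2)[OF st]] show ?thesis
    by (simp add: loop_simps)
qed

lemma \<Delta>_rdiv: "((s \<sslash> x, s' \<sslash> x'), (t \<sslash> y, t' \<sslash> y')) \<in> \<Delta>"
proof -
  have "(((s \<sslash> x) * y, (s' \<sslash> x') * y'), (s, s')) \<in> \<Delta>"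
    using \<Delta>_mult_left[OF \<Delta>_sym[OF xy] \<pi>_ops(3)[OF \<Delta>D(1)[OF st] \<Delta>D(1)[OF xy]]]
    by (simp add: loop_simps)
  from \<Delta>_rdiv_right[OF \<Delta>_trans[OF this st] \<Delta>D(2)[OF xy]] show ?thesis
    by (simp add: loop_simps)
qed

end

text \<open>Applying \<open>f\<close> in both coordinates is evaluating the term in the square, so
  compatibility extends by induction on terms.\<close>

lemma \<Delta>_term_operation:
  assumes "term_operation n f"
    and "\<forall>i<n. ((ss ! i, ss' ! i), (ts ! i, ts' ! i)) \<in> \<Delta>"
  shows "((f ss, f ss'), (f ts, f ts')) \<in> \<Delta>"
  using assms
  by (induction rule: term_operation.induct) (auto intro: \<Delta>_refl \<pi>_refl \<Delta>_mult \<Delta>_ldiv \<Delta>_rdiv)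

lemma centralizes: "centralizes \<alpha> \<beta> \<delta>"
  unfolding centralizes_def
proof (intro allI impI)
  fix n f a b us vs
  assume *: "term_operation (Suc n) f" "(a, b) \<in> \<alpha>" "\<forall>i<n. (us ! i, vs ! i) \<in> \<beta>"
    and eq: "(f (a # us), f (a # vs)) \<in> \<delta>"
  \<comment> \<open>Dividing \<open>a\<close> \<alpha> \<open>b\<close> on the right by
    \<open>a\<close> puts the quotient into the \<alpha>-class of 1.\<close>
  have "(b \<sslash> a, b \<sslash> a) \<in> \<epsilon>"
    using congruence_ops(3)[OF \<alpha> *(2) congruence_refl[OF \<alpha>], of a] congruence_refl[OF \<delta>]
    by (simp add: \<epsilon>_def)
  then have "((a, a), (b, b)) \<in> \<Delta>"
    by (simp add: \<Delta>_def \<pi>_refl)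
  moreover have "((u, v), (u, v)) \<in> \<Delta>" if "(u, v) \<in> \<beta>" for u v
    using that congruence_refl[OF \<delta>] by (intro \<Delta>_refl) (auto simp: \<pi>_def)
  \<comment> \<open>Index 0 carries the change from \<open>(a, a)\<close> to \<open>(b, b)\<close>;
    at later indices the pair \<open>(u, v)\<close> is unchanged.\<close>
  ultimately have "((f (a # us), f (a # vs)), (f (b # us), f (b # vs))) \<in> \<Delta>"
    using *(3) by (intro \<Delta>_term_operation[OF *(1)]) (auto simp: less_Suc_eq_0_disj)
  from \<Delta>D(3)[OF this] have "(f (b # us) \<sslash> f (a # us), f (b # vs) \<sslash> f (a # vs)) \<in> \<delta>"
    by (simp add: \<epsilon>_def)
  \<comment> \<open>Multiplying the quotients by their \<delta>-congruent denominators recovers the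
    numerators.\<close>
  from congruence_ops(1)[OF \<delta> this eq] show "(f (b # us), f (b # vs)) \<in> \<delta>"
    by (simp add: loop_simps)
qed

end

section \<open>The commutator as a generated congruence\<close>

context
  fixes \<alpha> \<beta> :: "'a::loop rel"
  assumes \<alpha>: "congruence \<alpha>" and \<beta>: "congruence \<beta>"
begin

text \<open>At first argument 1 both values are 1, hence congruent; centralizing carries this
  congruence from 1 to \<open>a\<close>.\<close>

lemma commutatorI:
  assumes "term_operation (Suc (length us)) f" "(1, a) \<in> \<alpha>" "list_all2 (\<lambda>u v. (u, v) \<in> \<beta>) us vs"
    and "f (1 # us) = 1" "f (1 # vs) = 1"
  shows "(f (a # us), f (a # vs)) \<in> commutator \<alpha> \<beta>"
  using centralizes_commutator[of \<alpha> \<beta>] assms congruence_refl[OF congruence_commutator]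
  unfolding centralizes_def list_all2_conv_all_nth by metis

text \<open>The argument of \<open>W\<close> sits at index 0, the place that
  \<open>centralizes\<close> varies along \<alpha>; the parameter follows it.\<close>

lemma family_pairs_Unary_subset_commutator:
  assumes "term_operation 2 (\<lambda>xs. W (xs ! 1) (xs ! 0))" and "\<And>u. W u 1 = 1"
  shows "family_pairs \<alpha> \<beta> (Unary W) \<subseteq> commutator \<alpha> \<beta>"
proof
  fix q assume "q \<in> family_pairs \<alpha> \<beta> (Unary W)"
  then obtain a u v where "q = (W u a, W v a)" "(1, a) \<in> \<alpha>" "(u, v) \<in> \<beta>"
    by auto
  then show "q \<in> commutator \<alpha> \<beta>"
    using commutatorI[of "[u]" "\<lambda>xs. W (xs ! 1) (xs ! 0)" a "[v]"] assms
    by (simp add: numeral_2_eq_2)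
qed

lemma family_pairs_Binary_subset_commutator:
  assumes "term_operation 3 (\<lambda>xs. W (xs ! 1) (xs ! 2) (xs ! 0))" and "\<And>u u'. W u u' 1 = 1"
  shows "family_pairs \<alpha> \<beta> (Binary W) \<subseteq> commutator \<alpha> \<beta>"
proof
  fix q assume "q \<in> family_pairs \<alpha> \<beta> (Binary W)"
  then obtain a u u' v v' where "q = (W u u' a, W v v' a)" "(1, a) \<in> \<alpha>" "(u, v) \<in> \<beta>" "(u', v') \<in> \<beta>"
    by auto
  then show "q \<in> commutator \<alpha> \<beta>"
    using commutatorI[of "[u, u']" "\<lambda>xs. W (xs ! 1) (xs ! 2) (xs ! 0)" a "[v, v']"] assms
    by (simp add: numeral_2_eq_2 numeral_3_eq_3)
qed

lemma family_pairs_subset_commutator: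
  assumes "W \<in> {Binary A_mult, Binary B_mult, Binary A_ldiv, Unary C_mult}"
  shows "family_pairs \<alpha> \<beta> W \<subseteq> commutator \<alpha> \<beta>"
proof -
  have "family_pairs \<alpha> \<beta> (Binary A_mult) \<subseteq> commutator \<alpha> \<beta>"
    "family_pairs \<alpha> \<beta> (Binary B_mult) \<subseteq> commutator \<alpha> \<beta>"
    "family_pairs \<alpha> \<beta> (Binary A_ldiv) \<subseteq> commutator \<alpha> \<beta>"
    by (rule family_pairs_Binary_subset_commutator; unfold family_map_eqs;
        (intro term_operation.intros)?; simp add: loop_simps)+
  moreover have "family_pairs \<alpha> \<beta> (Unary C_mult) \<subseteq> commutator \<alpha> \<beta>"
    by (rule family_pairs_Unary_subset_commutator; unfold family_map_eqs;
        (intro term_operation.intros)?; simp add: loop_simps)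
  ultimately show ?thesis
    using assms by blast
qed

text \<open>Taking the generated congruence for \<delta> in \<open>invariant\<close> shows that it
  centralizes, so it contains the commutator; conversely the commutator contains all generating
  pairs. Each case is left with proving \<open>invariant\<close>.\<close>

lemma commutator_eq_Cg:
  assumes \<W>: "\<W> \<subseteq> {Binary A_mult, Binary B_mult, Binary A_ldiv, Unary C_mult}"
    and invariant: "\<And>\<delta>. \<lbrakk>congruence \<delta>;
      \<And>W a u v. \<lbrakk>Unary W \<in> \<W>; (1, a) \<in> \<alpha>; (u, v) \<in> \<beta>\<rbrakk> \<Longrightarrow> (W u a, W v a) \<in> \<delta>;
      \<And>W a u u' v v'. \<lbrakk>Binary W \<in> \<W>; (1, a) \<in> \<alpha>; (u, v) \<in> \<beta>; (u', v') \<in> \<beta>\<rbrakk> \<Longrightarrow> (W u u' a, W v v' a) \<in> \<delta>\<rbrakk>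
      \<Longrightarrow> invariant_inner_maps \<alpha> \<beta> \<delta>"
  shows "commutator \<alpha> \<beta> = Cg (\<Union>W\<in>\<W>. family_pairs \<alpha> \<beta> W)"
proof
  let ?\<delta> = "Cg (\<Union>W\<in>\<W>. family_pairs \<alpha> \<beta> W)"
  have sub: "family_pairs \<alpha> \<beta> W \<subseteq> ?\<delta>" if "W \<in> \<W>" for W
    using Cg_superset that by blast
  have "invariant_inner_maps \<alpha> \<beta> ?\<delta>"
  proof (rule invariant[OF congruence_Cg])
    fix W a u v
    assume "Unary W \<in> \<W>" "(1, a) \<in> \<alpha>" "(u, v) \<in> \<beta>"
    then show "(W u a, W v a) \<in> ?\<delta>"
      using sub[of "Unary W"] unfolding family_pairs.simps by blast
  next
    fix W a u u' v v'
    assume "Binary W \<in> \<W>" "(1, a) \<in> \<alpha>" "(u, v) \<in> \<beta>" "(u', v') \<in> \<beta>"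
    then show "(W u u' a, W v v' a) \<in> ?\<delta>"
      using sub[of "Binary W"] unfolding family_pairs.simps by blast
  qed
  then show "commutator \<alpha> \<beta> \<subseteq> ?\<delta>"
    by (intro commutator_least congruence_Cg invariant_inner_maps.centralizes)
  show "?\<delta> \<subseteq> commutator \<alpha> \<beta>"
    using family_pairs_subset_commutator \<W> by (intro Cg_least congruence_commutator) blast
qed

end

section \<open>The four classes of loops\<close>

theorem corollary6p3:
  fixes \<alpha> \<beta> :: "'a::loop rel"
  assumes "congruence \<alpha>" and "congruence \<beta>"
  shows
    "commutator \<alpha> \<beta> = Cg (\<Union>W \<in> {Binary A_mult, Binary B_mult, Binary A_ldiv, Unary C_mult}.
        family_pairs \<alpha> \<beta> W) \<and>
     (inverse_property_loop TYPE('a) \<longrightarrow>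
       commutator \<alpha> \<beta> = Cg (\<Union>W \<in> {Binary A_mult, Unary C_mult}. family_pairs \<alpha> \<beta> W)) \<and>
     (group_loop TYPE('a) \<longrightarrow>
       commutator \<alpha> \<beta> = Cg (\<Union>W \<in> {Unary C_mult}. family_pairs \<alpha> \<beta> W)) \<and>
     (commutative_loop TYPE('a) \<longrightarrow>
       commutator \<alpha> \<beta> = Cg (\<Union>W \<in> {Binary A_mult, Binary A_ldiv}. family_pairs \<alpha> \<beta> W))"
proof (intro conjI impI)
  show "commutator \<alpha> \<beta> = Cg (\<Union>W \<in> {Binary A_mult, Binary B_mult, Binary A_ldiv, Unary C_mult}.
      family_pairs \<alpha> \<beta> W)" (is "_ = Cg (\<Union>W \<in> ?\<W>. _)")
  proof (rule commutator_eq_Cg[OF assms order_refl])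
    fix \<delta> :: "'a rel"
    assume "congruence \<delta>"
      and U: "\<And>W a u v. \<lbrakk>Unary W \<in> ?\<W>; (1, a) \<in> \<alpha>; (u, v) \<in> \<beta>\<rbrakk> \<Longrightarrow> (W u a, W v a) \<in> \<delta>"
      and B: "\<And>W a u u' v v'. \<lbrakk>Binary W \<in> ?\<W>; (1, a) \<in> \<alpha>; (u, v) \<in> \<beta>; (u', v') \<in> \<beta>\<rbrakk> \<Longrightarrow> (W u u' a, W v v' a) \<in> \<delta>"
    then show "invariant_inner_maps \<alpha> \<beta> \<delta>"
      using assms B[of A_mult] B[of B_mult] U[of C_mult] by unfold_locales auto
  qed
next
  assume ip: "inverse_property_loop TYPE('a)"
  show "commutator \<alpha> \<beta> = Cg (\<Union>W \<in> {Binary A_mult, Unary C_mult}. family_pairs \<alpha> \<beta> W)"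
  proof (rule commutator_eq_Cg[OF assms])
    fix \<delta> :: "'a rel"
    assume \<delta>: "congruence \<delta>"
      and U: "\<And>W a u v. \<lbrakk>Unary W \<in> {Binary A_mult, Unary C_mult}; (1, a) \<in> \<alpha>; (u, v) \<in> \<beta>\<rbrakk> \<Longrightarrow> (W u a, W v a) \<in> \<delta>"
      and B: "\<And>W a u u' v v'. \<lbrakk>Binary W \<in> {Binary A_mult, Unary C_mult}; (1, a) \<in> \<alpha>; (u, v) \<in> \<beta>; (u', v') \<in> \<beta>\<rbrakk>
        \<Longrightarrow> (W u u' a, W v v' a) \<in> \<delta>"
    \<comment> \<open>Inversion preserves every congruence; it is applied to the argument under
      \<alpha>, the parameters under \<beta> and the values under \<delta>, which carries invariance
      of \<open>A_mult\<close> over to its conjugate \<open>B_mult\<close>.\<close>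
    have inv: "(x \<setminus> 1, y \<setminus> 1) \<in> \<theta>" if "congruence \<theta>" "(x, y) \<in> \<theta>" for x y \<theta>
      using congruence_ops(2)[OF that congruence_refl[OF that(1)]] .
    have "(B_mult y z p, B_mult y' z' p) \<in> \<delta>"
      if "(1, p) \<in> \<alpha>" "(y, y') \<in> \<beta>" "(z, z') \<in> \<beta>" for p y y' z z'
      unfolding inverse_property_loop_B_mult[OF ip]
      using B[of A_mult, OF _ _ inv[OF assms(2) that(2)] inv[OF assms(2) that(3)]]
        inv[OF assms(1) that(1)] by (intro inv[OF \<delta>]) simp
    then show "invariant_inner_maps \<alpha> \<beta> \<delta>"
      using assms \<delta> B[of A_mult] U[of C_mult] by unfold_locales auto
  qed simp
next
  assume group: "group_loop TYPE('a)"
  show "commutator \<alpha> \<beta> = Cg (\<Union>W \<in> {Unary C_mult}. family_pairs \<alpha> \<beta> W)"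
  proof (rule commutator_eq_Cg[OF assms])
    fix \<delta> :: "'a rel"
    assume \<delta>: "congruence \<delta>"
      and U: "\<And>W a u v. \<lbrakk>Unary W \<in> {Unary C_mult}; (1, a) \<in> \<alpha>; (u, v) \<in> \<beta>\<rbrakk> \<Longrightarrow> (W u a, W v a) \<in> \<delta>"
    show "invariant_inner_maps \<alpha> \<beta> \<delta>"
      \<comment> \<open>Associativity makes \<open>A_mult\<close> and \<open>B_mult\<close> identity
        maps, so their invariance is reflexivity of \<delta>.\<close>
      using assms \<delta> U[of C_mult] congruence_refl[OF \<delta>]
      by unfold_locales (auto simp: group_loop_A_mult[OF group] group_loop_B_mult[OF group])
  qed simp
next
  assume comm: "commutative_loop TYPE('a)"
  show "commutator \<alpha> \<beta> = Cg (\<Union>W \<in> {Binary A_mult, Binary A_ldiv}. family_pairs \<alpha> \<beta> W)"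
  proof (rule commutator_eq_Cg[OF assms])
    fix \<delta> :: "'a rel"
    assume \<delta>: "congruence \<delta>"
      and B: "\<And>W a u u' v v'. \<lbrakk>Binary W \<in> {Binary A_mult, Binary A_ldiv}; (1, a) \<in> \<alpha>; (u, v) \<in> \<beta>; (u', v') \<in> \<beta>\<rbrakk>
        \<Longrightarrow> (W u u' a, W v v' a) \<in> \<delta>"
    show "invariant_inner_maps \<alpha> \<beta> \<delta>"
      \<comment> \<open>Commutativity identifies \<open>B_mult\<close> with \<open>A_mult\<close>
        and makes \<open>C_mult\<close> the identity.\<close>
      using assms \<delta> B[of A_mult] congruence_refl[OF \<delta>]
      by unfold_locales (auto simp: commutative_loop_B_mult[OF comm] commutative_loop_C_mult[OF comm])
  qed simp
qed

end
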